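(* Assume the following. ($A_1$) $X$ is a reflexive Banach space, and $K\subsetneq X$ is non-empty, closed and convex. ($A_3$) $X_j$ is a Banach space and $\gamma_j\in\mathcal{L}(X,X_j)$, with a constant $c_j>0$ such that $\|\gamma_j v\|_{X_j}\le c_j\|v\|_X$ for all $v\in X$. ($A_4$) $A\colon X\to X^*$ is pseudomonotone, and there is a constant $m_A>0$ such that $\langle Av_1-Av_2,v_1-v_2\rangle\ge m_A\|v_1-v_2\|_X^2$ for all $v_1,v_2\in X$. ($A_6$) $j\colon X_j\to\mathbb{R}$ is locally Lipschitz, and for some constants $c_0,c_1,\alpha_j\ge 0$, \[ \|\partial j(z)\|_{X_j^*}\le c_0+c_1\|z\|_{X_j}\quad\forall\,z\in X_j, \] \[ j^0(z_1;z_2-z_1)+j^0(z_2;z_1-z_2)\le\alpha_j\|z_1-z_2\|_{X_j}^2\quad\forall\,z_1,z_2\in X_j. \] ($A_7$)$'$ $\alpha_j c_j^2<m_A$. ($A_8$) $f\in X^*$. ($A_9$) For each discretization parameter $h>0$, $X^h\subset X$ is a finite dimensional subspace; for any $v\in X$ there exist $v^h\in X^h$ such that $\lim_{h\to 0}\|v^h-v\|_X=0$; and for any $v\in K$ there exist $v^h\in X^h\cap K$ such that $\lim_{h\to 0}\|v^h-v\|_X=0$. ($A_{10}$)$'$ $\gamma_j\colon X\to X_j$ is compact. Let $P\colon X\to X^*$ be a penalty operator for $K$. Let $u\in K$ be the unique solution of the hemivariational inequality \[ \langle Au,v-u\rangle+j^0(\gamma_j u;\gamma_j v-\gamma_j u)\ge\langle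 f,v-u\rangle\quad\forall\,v\in K, \] and, for $h,\epsilon>0$, let $u^h_\epsilon\in X^h$ be the unique solution of \[ \langle Au^h_\epsilon,v^h-u^h_\epsilon\rangle+\frac1\epsilon\langle Pu^h_\epsilon,v^h-u^h_\epsilon\rangle+j^0(\gamma_j u^h_\epsilon;\gamma_j v^h-\gamma_j u^h_\epsilon)\ge\langle f,v^h-u^h_\epsilon\rangle\quad\forall\,v^h\in X^h. \] Then \[ u^h_\epsilon\to u\quad\text{in }X\text{ as }h,\epsilon\to 0. \]
   Context: All spaces are real. $X^*$ is the dual of $X$, $\langle\cdot,\cdot\rangle$ is the duality pairing of $X^*$ and $X$, and $\mathcal{L}(X,Y)$ is the space of continuous linear operators from $X$ to $Y$; $\rightharpoonup$ denotes weak convergence. An operator $A\colon X\to X^*$ is pseudomonotone if it is bounded (maps bounded sets to bounded sets) and $u_n\rightharpoonup u$ in $X$ together with $\limsup_{n\to\infty}\langle Au_n,u_n-u\rangle\le 0$ imply $\langle Au,u-v\rangle\le\liminf_{n\to\infty}\langle Au_n,u_n-v\rangle$ for all $v\in X$. It is demicontinuous if $u_n\to u$ in $X$ implies $Au_n\rightharpoonup Au$ in $X^*$. A penalty operator for the set $K$ is an operator $P\colon X\to X^*$ that is bounded (maps bounded sets to bounded sets), demicontinuous, monotone, and satisfies $\mathrm{Ker}(P)=\{v\in X: Pv=0\}=K$. For a locally Lipschitz $\psi\colon Y\to\mathbb{R}$ on a normed space $Y$, the Clarke generalized directional derivative at $x$ in direction $v$ is $\psi^0(x;v)=\limsup_{y\to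 x,\ \lambda\downarrow 0}\frac{\psi(y+\lambda v)-\psi(y)}{\lambda}$, and the Clarke subdifferential is $\partial\psi(x)=\{\zeta\in Y^*: \psi^0(x;v)\ge\langle\zeta,v\rangle\ \forall v\in Y\}$. A bound $\|\partial j(z)\|_{X_j^*}\le C$ means $\|\zeta\|_{X_j^*}\le C$ for every $\zeta\in\partial j(z)$. Under ($A_1$), ($A_3$), ($A_4$), ($A_6$), ($A_7$)$'$, ($A_8$), both the constrained inequality on $K$ and the discrete penalized inequality on $X^h$ have unique solutions. The parameters $h$ and $\epsilon$ tend to zero simultaneously and independently: the convergence means that for every $\eta>0$ there are $h_0,\epsilon_0>0$ such that $\|u^h_\epsilon-u\|_X<\eta$ whenever $0<h<h_0$ and $0<\epsilon<\epsilon_0$. *)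

theory Defs
  imports "HOL-Analysis.Analysis"
begin

text \<open>The dual of a real normed space \<open>'a\<close> is the type \<open>'a \<Rightarrow>\<^sub>L real\<close> of bounded linear functionals
  with the operator norm; the pairing of \<open>\<zeta>\<close> with \<open>v\<close> is the application \<open>blinfun_apply \<zeta> v\<close>.\<close>

text \<open>Surjectivity of the canonical embedding into the bidual.\<close>

definition reflexive_space :: "'a::real_normed_vector itself \<Rightarrow> bool" where
  "reflexive_space _ \<longleftrightarrow>
     (\<forall>\<Phi> :: ('a \<Rightarrow>\<^sub>L real) \<Rightarrow>\<^sub>L real. \<exists>x. \<forall>\<zeta>. blinfun_apply \<Phi> \<zeta> = blinfun_apply \<zeta> x)"

definition weakly_tendsto :: "(nat \<Rightarrow> 'a::real_normed_vector) \<Rightarrow> 'a \<Rightarrow> bool" where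
  "weakly_tendsto x l \<longleftrightarrow>
     (\<forall>\<zeta> :: 'a \<Rightarrow>\<^sub>L real. (\<lambda>n. blinfun_apply \<zeta> (x n)) \<longlonglongrightarrow> blinfun_apply \<zeta> l)"

definition bounded_operator :: "('a::real_normed_vector \<Rightarrow> 'b::real_normed_vector) \<Rightarrow> bool" where
  "bounded_operator T \<longleftrightarrow> (\<forall>S. bounded S \<longrightarrow> bounded (T ` S))"

definition compact_operator :: "('a::real_normed_vector \<Rightarrow>\<^sub>L 'b::real_normed_vector) \<Rightarrow> bool" where
  "compact_operator T \<longleftrightarrow> (\<forall>S. bounded S \<longrightarrow> compact (closure (blinfun_apply T ` S)))"

definition pseudomonotone :: "('a::real_normed_vector \<Rightarrow> ('a \<Rightarrow>\<^sub>L real)) \<Rightarrow> bool" where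
  "pseudomonotone A \<longleftrightarrow> bounded_operator A \<and>
     (\<forall>x l. weakly_tendsto x l \<longrightarrow>
        limsup (\<lambda>n. ereal (blinfun_apply (A (x n)) (x n - l))) \<le> 0 \<longrightarrow>
        (\<forall>v. ereal (blinfun_apply (A l) (l - v))
              \<le> liminf (\<lambda>n. ereal (blinfun_apply (A (x n)) (x n - v)))))"

text \<open>The weak convergence of the images is the one tested against the bidual.\<close>

definition demicontinuous :: "('a::real_normed_vector \<Rightarrow> ('a \<Rightarrow>\<^sub>L real)) \<Rightarrow> bool" where
  "demicontinuous A \<longleftrightarrow>
     (\<forall>x l. x \<longlonglongrightarrow> l \<longrightarrow> weakly_tendsto (\<lambda>n. A (x n)) (A l))"

definition monotone_operator :: "('a::real_normed_vector \<Rightarrow> ('a \<Rightarrow>\<^sub>L real)) \<Rightarrow> bool" where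
  "monotone_operator A \<longleftrightarrow> (\<forall>u v. 0 \<le> blinfun_apply (A u - A v) (u - v))"

definition penalty_operator ::
    "'a::real_normed_vector set \<Rightarrow> ('a \<Rightarrow> ('a \<Rightarrow>\<^sub>L real)) \<Rightarrow> bool" where
  "penalty_operator K P \<longleftrightarrow>
     bounded_operator P \<and> demicontinuous P \<and> monotone_operator P \<and> {v. P v = 0} = K"

definition locally_lipschitz :: "('a::real_normed_vector \<Rightarrow> real) \<Rightarrow> bool" where
  "locally_lipschitz \<psi> \<longleftrightarrow> (\<forall>x. \<exists>r>0. \<exists>L. L-lipschitz_on (ball x r) \<psi>)"

text \<open>The upper limit is taken in the extended reals, so that it exists for every \<open>\<psi>\<close>; it is
  finite when \<open>\<psi>\<close> is locally Lipschitz. The base point \<open>y\<close> ranges over full neighbourhoods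
  of \<open>x\<close>, i.e. \<open>y = x\<close> is allowed.\<close>

definition clarke_deriv :: "('a::real_normed_vector \<Rightarrow> real) \<Rightarrow> 'a \<Rightarrow> 'a \<Rightarrow> ereal" where
  "clarke_deriv \<psi> x v =
     Limsup (nhds x \<times>\<^sub>F at_right (0::real)) (\<lambda>(y, t). ereal ((\<psi> (y + t *\<^sub>R v) - \<psi> y) / t))"

definition clarke_subdiff :: "('a::real_normed_vector \<Rightarrow> real) \<Rightarrow> 'a \<Rightarrow> ('a \<Rightarrow>\<^sub>L real) set" where
  "clarke_subdiff \<psi> x = {\<zeta>. \<forall>v. clarke_deriv \<psi> x v \<ge> ereal (blinfun_apply \<zeta> v)}"

definition finite_dim_subspace :: "'a::real_vector set \<Rightarrow> bool" where
  "finite_dim_subspace S \<longleftrightarrow> subspace S \<and> (\<exists>B. finite B \<and> S = span B)"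

end

theory Submission
  imports Defs "HOL-Real_Asymp.Real_Asymp"
begin

text \<open>Write \<open>n = u\<^sub>h h \<epsilon>\<close> and let \<open>v \<in> X\<^sub>h h \<inter> K\<close> approximate \<open>u\<close>. Testing the discrete inequality with \<open>v\<close>
  the penalty term drops out by monotonicity, and strong monotonicity of \<open>A\<close> together with the
  relaxed monotonicity of the Clarke derivative bounds \<open>n\<close> and then gives
  \<open>(m\<^sub>A - \<alpha>\<^sub>j c\<^sub>j\<^sup>2) \<parallel>n - u\<parallel>\<^sup>2 \<le> \<langle>f - A u, n - u\<rangle> - j\<^sup>0(\<gamma> u; \<gamma> n - \<gamma> u) + o(1)\<close>.
  Every weak cluster point \<open>w\<close> of the \<open>n\<close> lies in \<open>K\<close>: testing with approximations of an arbitrary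
  \<open>z \<in> X\<close> gives \<open>\<langle>P z, w - z\<rangle> \<le> 0\<close>, hence \<open>P w = 0\<close> by Minty. By Hahn--Banach the sublinear map
  \<open>j\<^sup>0(\<gamma> u; \<gamma> \<cdot>)\<close> has a continuous linear minorant touching it at \<open>w - u\<close>, so along a filter
  converging weakly to \<open>w\<close> the right-hand side is asymptotically at most
  \<open>\<langle>f - A u, w - u\<rangle> - j\<^sup>0(\<gamma> u; \<gamma> w - \<gamma> u)\<close>, which is \<open>\<le> 0\<close> by the inequality for \<open>u\<close>.\<close>


section \<open>Sublinear functions and the Hahn--Banach theorem\<close>

definition sublinear :: "('a::real_vector \<Rightarrow> real) \<Rightarrow> bool" where
  "sublinear p \<longleftrightarrow> (\<forall>x y. p (x + y) \<le> p x + p y) \<and> (\<forall>c>0. \<forall>x. p (c *\<^sub>R x) \<le> c * p x)"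

lemma sublinearI:
  assumes "\<And>x y. p (x + y) \<le> p x + p y" "\<And>c x. c > 0 \<Longrightarrow> p (c *\<^sub>R x) \<le> c * p x"
  shows "sublinear p"
  using assms by (simp add: sublinear_def)

lemma sublinear_add: "sublinear p \<Longrightarrow> p (x + y) \<le> p x + p y"
  by (simp add: sublinear_def)

lemma sublinear_scaleR_le: "sublinear p \<Longrightarrow> c > 0 \<Longrightarrow> p (c *\<^sub>R x) \<le> c * p x"
  by (simp add: sublinear_def)

lemma sublinear_zero:
  assumes "sublinear p" shows "p 0 = 0"
  using sublinear_scaleR_le[OF assms, of 2 0] sublinear_scaleR_le[OF assms, of "1/2" 0] by simp

text \<open>The factor \<open>inverse c\<close>, applied at \<open>c *\<^sub>R x\<close>, reverses
  the inequality; hence the definition asks for \<open>\<le>\<close> only.\<close>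

lemma sublinear_scaleR:
  assumes "sublinear p" "c \<ge> 0" shows "p (c *\<^sub>R x) = c * p x"
proof (cases "c = 0")
  case False
  then have c: "c > 0" using assms by simp
  have "p (inverse c *\<^sub>R (c *\<^sub>R x)) \<le> inverse c * p (c *\<^sub>R x)"
    using c by (intro sublinear_scaleR_le assms) simp
  then have "c * p x \<le> p (c *\<^sub>R x)"
    using c by (simp add: field_simps)
  with sublinear_scaleR_le[OF assms(1) c, of x] show ?thesis by simp
qed (use sublinear_zero[OF assms(1)] in simp)

lemma sublinear_minus: "sublinear p \<Longrightarrow> - p (- x) \<le> p x"
  using sublinear_add[of p x "- x"] sublinear_zero[of p] by simp

text \<open>The largest sublinear minorant of \<open>p\<close> whose value at \<open>- a\<close> is at most \<open>- p a\<close>: it forces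
  additivity of minimal sublinear maps, and tangency at \<open>a\<close> of linear minorants.\<close>

definition shear :: "('a::real_vector \<Rightarrow> real) \<Rightarrow> 'a \<Rightarrow> 'a \<Rightarrow> real" where
  "shear p a x = (INF t\<in>{0..}. p (x + t *\<^sub>R a) - t * p a)"

text \<open>The lower bound \<open>- p (- x)\<close> does not depend on \<open>t\<close>, so the
  infimum in \<open>shear\<close> is a genuine one.\<close>

lemma shear_bdd_below:
  assumes "sublinear p" shows "bdd_below ((\<lambda>t. p (x + t *\<^sub>R a) - t * p a) ` {0..})"
proof (rule bdd_belowI2)
  fix t :: real assume "t \<in> {0..}"
  then have "t * p a = p ((x + t *\<^sub>R a) + (- x))"
    using sublinear_scaleR[OF assms] by simp
  also have "\<dots> \<le> p (x + t *\<^sub>R a) + p (- x)" by (rule sublinear_add[OF assms])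
  finally show "- p (- x) \<le> p (x + t *\<^sub>R a) - t * p a" by simp
qed

lemma shear_le:
  assumes "sublinear p" "t \<ge> 0" shows "shear p a x \<le> p (x + t *\<^sub>R a) - t * p a"
  unfolding shear_def by (rule cINF_lower[OF shear_bdd_below[OF assms(1)]]) (use assms in simp)

lemma le_shear: "(\<And>t. t \<ge> 0 \<Longrightarrow> c \<le> p (x + t *\<^sub>R a) - t * p a) \<Longrightarrow> c \<le> shear p a x"
  unfolding shear_def by (rule cINF_greatest) auto

lemma shear_le_self: "sublinear p \<Longrightarrow> shear p a x \<le> p x"
  using shear_le[of p 0] by simp

text \<open>The parameters \<open>t \<ge> 0\<close> form a cone: competitors \<open>s\<close> for
  \<open>x\<close> and \<open>t\<close> for \<open>y\<close> combine to \<open>s + t\<close> for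
  \<open>x + y\<close>, and \<open>t\<close> for \<open>x\<close> becomes \<open>c * t\<close> for
  \<open>c *\<^sub>R x\<close>.\<close>

lemma sublinear_shear:
  assumes p: "sublinear p" shows "sublinear (shear p a)"
proof (rule sublinearI)
  fix x y
  have *: "shear p a (x + y) \<le> (p (x + s *\<^sub>R a) - s * p a) + (p (y + t *\<^sub>R a) - t * p a)"
    if "s \<ge> 0" "t \<ge> 0" for s t
  proof -
    have "shear p a (x + y) \<le> p ((x + y) + (s + t) *\<^sub>R a) - (s + t) * p a"
      using that by (intro shear_le p) simp
    also have "(x + y) + (s + t) *\<^sub>R a = (x + s *\<^sub>R a) + (y + t *\<^sub>R a)"
      by (simp add: algebra_simps)
    also have "p \<dots> \<le> p (x + s *\<^sub>R a) + p (y + t *\<^sub>R a)" by (rule sublinear_add[OF p])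
    finally show ?thesis by (simp add: algebra_simps)
  qed
  have "shear p a (x + y) - (p (x + s *\<^sub>R a) - s * p a) \<le> shear p a y" if "s \<ge> 0" for s
  proof (rule le_shear)
    fix t :: real assume "t \<ge> 0"
    from *[OF that this] show "shear p a (x + y) - (p (x + s *\<^sub>R a) - s * p a)
      \<le> p (y + t *\<^sub>R a) - t * p a" by simp
  qed
  then have "shear p a (x + y) - shear p a y \<le> shear p a x"
    by (intro le_shear) (simp add: algebra_simps)
  then show "shear p a (x + y) \<le> shear p a x + shear p a y" by simp
next
  fix c :: real and x assume c: "c > 0"
  have "shear p a (c *\<^sub>R x) / c \<le> p (x + t *\<^sub>R a) - t * p a" if "t \<ge> 0" for t
  proof -
    have "shear p a (c *\<^sub>R x) \<le> p (c *\<^sub>R x + (c * t) *\<^sub>R a) - (c * t) * p a"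
      using that c by (intro shear_le p) simp
    also have "c *\<^sub>R x + (c * t) *\<^sub>R a = c *\<^sub>R (x + t *\<^sub>R a)" by (simp add: algebra_simps)
    also have "p \<dots> = c * p (x + t *\<^sub>R a)" using c by (intro sublinear_scaleR p) simp
    finally show ?thesis using c by (simp add: field_simps)
  qed
  then have "shear p a (c *\<^sub>R x) / c \<le> shear p a x" by (rule le_shear)
  then show "shear p a (c *\<^sub>R x) \<le> c * shear p a x" using c by (simp add: field_simps)
qed

text \<open>Minimality forces \<open>shear q a = q\<close> for every \<open>a\<close>; the
  competitor \<open>t = 1\<close> then reads \<open>q x + q a \<le> q (x + a)\<close>, the missing
  half of additivity.\<close>

lemma minimal_sublinear_linear:
  assumes q: "sublinear q" and min: "\<And>r. sublinear r \<Longrightarrow> r \<le> q \<Longrightarrow> r = q"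
  shows "linear q"
proof -
  have "shear q a = q" for a
    using q by (intro min sublinear_shear) (simp_all add: le_fun_def shear_le_self)
  then have "q x + q a \<le> q (x + a)" for x a
    using shear_le[OF q, of 1 a x] by simp
  then have add: "q (x + a) = q x + q a" for x a
    using sublinear_add[OF q, of x a] by (simp add: antisym)
  have neg: "q (- x) = - q x" for x
    using add[of x "- x"] sublinear_zero[OF q] by simp
  have "q (c *\<^sub>R x) = c * q x" for c x
  proof (cases "c \<ge> 0")
    case False
    then have "q ((- c) *\<^sub>R x) = (- c) * q x" by (intro sublinear_scaleR q) simp
    then show ?thesis by (simp add: neg)
  qed (simp add: sublinear_scaleR q)
  with add show ?thesis by (intro linearI) simp_all
qed

text \<open>This supplies the lower bounds for Zorn's lemma. Members \<open>q\<close> and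
  \<open>r\<close> that are nearly optimal at \<open>x\<close> and at \<open>y\<close> may differ;
  in a chain the smaller of them serves at both points.\<close>

lemma sublinear_INF_chain:
  fixes C :: "('a::real_vector \<Rightarrow> real) set"
  assumes ne: "C \<noteq> {}" and sub: "\<And>q. q \<in> C \<Longrightarrow> sublinear q"
    and bdd: "\<And>x. bdd_below ((\<lambda>q. q x) ` C)"
    and chain: "\<And>q r. q \<in> C \<Longrightarrow> r \<in> C \<Longrightarrow> q \<le> r \<or> r \<le> q"
  shows "sublinear (\<lambda>x. INF q\<in>C. q x)"
proof (rule sublinearI)
  fix x y
  have *: "(INF q\<in>C. q (x + y)) \<le> q x + r y" if qr: "q \<in> C" "r \<in> C" for q r
  proof -
    obtain s where s: "s \<in> C" "s \<le> q" "s \<le> r"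
      using chain[OF qr] qr by blast
    have "(INF q\<in>C. q (x + y)) \<le> s (x + y)" by (rule cINF_lower[OF bdd s(1)])
    also have "\<dots> \<le> s x + s y" by (rule sublinear_add[OF sub[OF s(1)]])
    also have "\<dots> \<le> q x + r y" using s by (intro add_mono) (auto simp: le_fun_def)
    finally show ?thesis .
  qed
  have "(INF q\<in>C. q (x + y)) - q x \<le> (INF r\<in>C. r y)" if "q \<in> C" for q
    by (rule cINF_greatest[OF ne]) (use *[OF that] in \<open>simp add: algebra_simps\<close>)
  then have "(INF q\<in>C. q (x + y)) - (INF r\<in>C. r y) \<le> (INF q\<in>C. q x)"
    by (intro cINF_greatest[OF ne]) (simp add: algebra_simps)
  then show "(INF q\<in>C. q (x + y)) \<le> (INF q\<in>C. q x) + (INF q\<in>C. q y)" by simp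
next
  fix c :: real and x assume c: "c > 0"
  have "(INF q\<in>C. q (c *\<^sub>R x)) / c \<le> q x" if "q \<in> C" for q
  proof -
    have "(INF q\<in>C. q (c *\<^sub>R x)) \<le> q (c *\<^sub>R x)" by (rule cINF_lower[OF bdd that])
    also have "\<dots> \<le> c * q x" by (rule sublinear_scaleR_le[OF sub[OF that] c])
    finally show ?thesis using c by (simp add: field_simps)
  qed
  then have "(INF q\<in>C. q (c *\<^sub>R x)) / c \<le> (INF q\<in>C. q x)" by (intro cINF_greatest[OF ne])
  then show "(INF q\<in>C. q (c *\<^sub>R x)) \<le> c * (INF q\<in>C. q x)" using c by (simp add: field_simps)
qed

text \<open>Zorn's lemma, with the order reversed so that maximal means pointwise minimal, gives a
  minimal sublinear minorant of \<open>p\<close>; such a function is linear.\<close>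

lemma sublinear_dominates_linear:
  fixes p :: "'a::real_vector \<Rightarrow> real"
  assumes p: "sublinear p"
  shows "\<exists>g. linear g \<and> g \<le> p"
proof -
  define S where "S = {q. sublinear q \<and> q \<le> p}"
  have "\<exists>m\<in>S. \<forall>a\<in>S. m \<ge> a \<longrightarrow> a = m"
  proof (rule predicate_Zorn)
    show "partial_order_on S (relation_of (\<ge>) S)"
      by (rule partial_order_on_relation_ofI) auto
  next
    fix C assume C: "C \<in> Chains (relation_of (\<ge>) S)"
    then have CS: "C \<subseteq> S" by (rule Chains_relation_of)
    have chain: "q \<le> r \<or> r \<le> q" if "q \<in> C" "r \<in> C" for q r
      using C that by (auto simp: Chains_def relation_of_def)
    show "\<exists>u\<in>S. \<forall>a\<in>C. a \<ge> u"
    proof (cases "C = {}")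
      case True
      then show ?thesis using p by (auto simp: S_def)
    next
      case False
      \<comment> \<open>At \<open>x\<close> every sublinear minorant of \<open>p\<close> lies above
        \<open>- p (- x)\<close>.\<close>
      have bdd: "bdd_below ((\<lambda>q. q x) ` C)" for x
      proof (rule bdd_belowI2)
        fix q assume "q \<in> C"
        then have "sublinear q" "q (- x) \<le> p (- x)" using CS by (auto simp: S_def le_fun_def)
        then show "- p (- x) \<le> q x" using sublinear_minus[of q x] by simp
      qed
      define i where "i = (\<lambda>x. INF q\<in>C. q x)"
      have "sublinear i"
        unfolding i_def using CS by (intro sublinear_INF_chain False bdd chain) (auto simp: S_def)
      moreover have le: "i \<le> q" if "q \<in> C" for q
        unfolding i_def le_fun_def using cINF_lower[OF bdd that] by auto
      moreover have "i \<le> p"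
        using False CS le by (force simp: S_def intro: order_trans)
      ultimately show ?thesis by (auto simp: S_def)
    qed
  qed
  then obtain m where m: "m \<in> S" "\<And>a. a \<in> S \<Longrightarrow> a \<le> m \<Longrightarrow> a = m" by blast
  have "linear m"
    using m by (intro minimal_sublinear_linear) (auto simp: S_def intro: order_trans)
  then show ?thesis using m by (auto simp: S_def)
qed

text \<open>A linear minorant \<open>g\<close> of \<open>shear p a\<close> lies below
  \<open>p\<close>, and at \<open>- a\<close> the competitor \<open>t = 1\<close> gives
  \<open>g (- a) \<le> - p a\<close>, that is, \<open>p a \<le> g a\<close>.\<close>

theorem hahn_banach_support:
  fixes p :: "'a::real_vector \<Rightarrow> real"
  assumes p: "sublinear p"
  obtains g where "linear g" "\<And>x. g x \<le> p x" "g a = p a"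
proof -
  obtain g where g: "linear g" "g \<le> shear p a"
    using sublinear_dominates_linear[OF sublinear_shear[OF p]] by blast
  have le: "g x \<le> p x" for x
    using g(2) shear_le_self[OF p] by (meson le_funD order_trans)
  have "g (- a) \<le> shear p a (- a)" using g(2) by (simp add: le_fun_def)
  also have "\<dots> \<le> - p a" using shear_le[OF p, of 1 a "- a"] sublinear_zero[OF p] by simp
  finally have "g a = p a" using le[of a] linear_neg[OF g(1), of a] by simp
  with g le that show thesis by blast
qed

text \<open>The one-sided bound suffices: at \<open>- x\<close> it bounds the linear minorant from
  below.\<close>

lemma sublinear_support_blinfun:
  fixes p :: "'a::real_normed_vector \<Rightarrow> real"
  assumes p: "sublinear p" and bnd: "\<And>x. p x \<le> L * norm x"
  obtains \<zeta> :: "'a \<Rightarrow>\<^sub>L real"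
  where "\<And>x. blinfun_apply \<zeta> x \<le> p x" "blinfun_apply \<zeta> a = p a"
proof -
  obtain g where g: "linear g" "\<And>x. g x \<le> p x" "g a = p a"
    using hahn_banach_support[OF p] by blast
  have "norm (g x) \<le> norm x * L" for x
    using order_trans[OF g(2)[of x] bnd] order_trans[OF g(2)[of "- x"] bnd] linear_neg[OF g(1), of x]
    by (simp add: abs_le_iff mult.commute)
  with g(1) have "bounded_linear g" 
    by (auto simp: bounded_linear_def bounded_linear_axioms_def)
  then have "blinfun_apply (Blinfun g) = g" by (rule bounded_linear_Blinfun_apply)
  with g that[of "Blinfun g"] show thesis by simp
qed

section \<open>Clarke derivatives as finite sublinear functions\<close>

lemma tendsto_clarke_base:
  fixes z v :: "'a::real_normed_vector"
  shows "((\<lambda>(y, t). y + t *\<^sub>R v) \<longlongrightarrow> z) (nhds z \<times>\<^sub>F at_right (0::real))"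
proof -
  have "((\<lambda>s. fst s) \<longlongrightarrow> z) (nhds z \<times>\<^sub>F at_right (0::real))"
    by (rule filterlim_fst)
  moreover have "((\<lambda>s. snd s) \<longlongrightarrow> 0) (nhds z \<times>\<^sub>F at_right (0::real))"
    by (rule filterlim_mono[OF filterlim_snd at_within_le_nhds order_refl])
  ultimately have "((\<lambda>s. fst s + snd s *\<^sub>R v) \<longlongrightarrow> z + 0 *\<^sub>R v) (nhds z \<times>\<^sub>F at_right (0::real))"
    by (intro tendsto_intros)
  then show ?thesis by (simp add: case_prod_unfold)
qed

lemma clarke_deriv_bounds:
  assumes "locally_lipschitz \<psi>"
  obtains L where "\<And>v. clarke_deriv \<psi> z v \<le> ereal (L * norm v)"
    "\<And>v. ereal (- (L * norm v)) \<le> clarke_deriv \<psi> z v"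
proof -
  obtain r L where r: "r > 0" and L: "L-lipschitz_on (ball z r) \<psi>"
    using assms unfolding locally_lipschitz_def by blast
  let ?F = "nhds z \<times>\<^sub>F at_right (0::real)"
  have F: "?F \<noteq> bot" by (simp add: prod_filter_eq_bot)
  have ev: "\<forall>\<^sub>F (y, t) in ?F. \<bar>(\<psi> (y + t *\<^sub>R v) - \<psi> y) / t\<bar> \<le> L * norm v" for v
  proof -
    have "\<forall>\<^sub>F s in ?F. (case s of (y, t) \<Rightarrow> y + t *\<^sub>R v) \<in> ball z r"
      using r by (intro topological_tendstoD[OF tendsto_clarke_base]) auto
    \<comment> \<open>With direction \<open>0\<close> this says that \<open>y\<close> itself is
      eventually in the ball.\<close>
    moreover have "\<forall>\<^sub>F s in ?F. (case s of (y, t) \<Rightarrow> y + t *\<^sub>R 0) \<in> ball z r"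
      using r by (intro topological_tendstoD[OF tendsto_clarke_base]) auto
    moreover have "\<forall>\<^sub>F s in ?F. snd s > (0::real)"
      by (rule eventually_compose_filterlim[OF _ filterlim_snd]) (rule eventually_at_right_less)
    ultimately show ?thesis
    proof eventually_elim
      case (elim s)
      obtain y t where s: "s = (y, t)" by force
      have "dist (\<psi> (y + t *\<^sub>R v)) (\<psi> y) \<le> L * dist (y + t *\<^sub>R v) y"
        using elim s by (intro lipschitz_onD[OF L]) auto
      then show ?case using elim s by (simp add: dist_norm field_simps)
    qed
  qed
  show thesis
  proof (rule that[of L])
    fix v
    show "clarke_deriv \<psi> z v \<le> ereal (L * norm v)"
      unfolding clarke_deriv_def
      by (rule Limsup_bounded, rule eventually_mono[OF ev[of v]])
        (auto simp del: abs_divide simp: abs_le_iff)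
    show "ereal (- (L * norm v)) \<le> clarke_deriv \<psi> z v"
      unfolding clarke_deriv_def
      by (rule le_Limsup[OF F], rule eventually_mono[OF ev[of v]])
        (auto simp del: abs_divide simp: abs_le_iff)
  qed
qed

text \<open>\<open>real_of_ereal\<close> sends infinite values to \<open>0\<close>; for locally
  Lipschitz \<psi> the derivative is finite, so no information is lost and \<open>sublinear\<close>
  can speak of it.\<close>

definition clarke_real :: "('a::real_normed_vector \<Rightarrow> real) \<Rightarrow> 'a \<Rightarrow> 'a \<Rightarrow> real" where
  "clarke_real \<psi> z v = real_of_ereal (clarke_deriv \<psi> z v)"

lemma clarke_deriv_eq_real:
  assumes "locally_lipschitz \<psi>" shows "clarke_deriv \<psi> z v = ereal (clarke_real \<psi> z v)"
proof -
  obtain L where "clarke_deriv \<psi> z v \<le> ereal (L * norm v)"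
    "ereal (- (L * norm v)) \<le> clarke_deriv \<psi> z v"
    using clarke_deriv_bounds[OF assms] by metis
  then show ?thesis by (cases "clarke_deriv \<psi> z v") (auto simp: clarke_real_def)
qed

text \<open>Eventual bounds on the difference quotients can be transported along a change of the
  pair \<open>(y, t)\<close>, which is how sublinearity is obtained.\<close>

lemma clarke_real_le_iff:
  assumes "locally_lipschitz \<psi>"
  shows "clarke_real \<psi> z v \<le> c \<longleftrightarrow>
    (\<forall>d>c. \<forall>\<^sub>F (y, t) in nhds z \<times>\<^sub>F at_right 0. (\<psi> (y + t *\<^sub>R v) - \<psi> y) / t < d)"
    (is "_ \<longleftrightarrow> ?R")
proof -
  let ?F = "nhds z \<times>\<^sub>F at_right (0::real)"
  have "clarke_real \<psi> z v \<le> c \<longleftrightarrow> clarke_deriv \<psi> z v \<le> ereal c"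
    using clarke_deriv_eq_real[OF assms] by simp
  also have "\<dots> \<longleftrightarrow> (\<forall>d>ereal c. \<forall>\<^sub>F s in ?F.
      (case s of (y, t) \<Rightarrow> ereal ((\<psi> (y + t *\<^sub>R v) - \<psi> y) / t)) < d)"
    unfolding clarke_deriv_def by (rule Limsup_le_iff)
  also have "\<dots> \<longleftrightarrow> ?R"
  proof
    assume H: "\<forall>d>ereal c. \<forall>\<^sub>F s in ?F.
      (case s of (y, t) \<Rightarrow> ereal ((\<psi> (y + t *\<^sub>R v) - \<psi> y) / t)) < d"
    show ?R
    proof (intro allI impI)
      fix d assume "c < d"
      with H show "\<forall>\<^sub>F (y, t) in ?F. (\<psi> (y + t *\<^sub>R v) - \<psi> y) / t < d"
        by (auto simp: case_prod_unfold dest!: spec[of _ "ereal d"])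
    qed
  next
    assume R: ?R
    show "\<forall>d>ereal c. \<forall>\<^sub>F s in ?F.
      (case s of (y, t) \<Rightarrow> ereal ((\<psi> (y + t *\<^sub>R v) - \<psi> y) / t)) < d"
    proof (intro allI impI)
      fix d assume "ereal c < d"
      then show "\<forall>\<^sub>F s in ?F. (case s of (y, t) \<Rightarrow> ereal ((\<psi> (y + t *\<^sub>R v) - \<psi> y) / t)) < d"
        using R by (cases d) (auto simp: case_prod_unfold)
    qed
  qed
  finally show ?thesis .
qed

text \<open>The quotient in direction \<open>v + w\<close> at \<open>y\<close> is the one for
  \<open>v\<close> at \<open>y\<close> plus the one for \<open>w\<close> at
  \<open>y + t *\<^sub>R v\<close>, and this shifted base point still tends to \<open>z\<close>.
  Homogeneity is the substitution of \<open>c * t\<close> for \<open>t\<close>.\<close>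

lemma sublinear_clarke_real:
  assumes \<psi>: "locally_lipschitz \<psi>"
  shows "sublinear (clarke_real \<psi> z)"
proof (rule sublinearI)
  let ?F = "nhds z \<times>\<^sub>F at_right (0::real)"
  fix v w
  show "clarke_real \<psi> z (v + w) \<le> clarke_real \<psi> z v + clarke_real \<psi> z w"
    unfolding clarke_real_le_iff[OF \<psi>]
  proof (intro allI impI)
    fix d assume "clarke_real \<psi> z v + clarke_real \<psi> z w < d"
    then obtain e where e: "clarke_real \<psi> z v < e" "clarke_real \<psi> z w < d - e"
      using dense[of "clarke_real \<psi> z v" "d - clarke_real \<psi> z w"] by auto
    have v: "\<forall>\<^sub>F (y, t) in ?F. (\<psi> (y + t *\<^sub>R v) - \<psi> y) / t < e"
      using clarke_real_le_iff[OF \<psi>, of z v "clarke_real \<psi> z v"] e by simp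
    have w: "\<forall>\<^sub>F (y, t) in ?F. (\<psi> (y + t *\<^sub>R w) - \<psi> y) / t < d - e"
      using clarke_real_le_iff[OF \<psi>, of z w "clarke_real \<psi> z w"] e by simp
    have "filterlim (\<lambda>s. ((case s of (y, t) \<Rightarrow> y + t *\<^sub>R v), snd s)) ?F ?F"
      by (intro filterlim_Pair tendsto_clarke_base filterlim_snd)
    then have "\<forall>\<^sub>F s in ?F. case ((case s of (y, t) \<Rightarrow> y + t *\<^sub>R v), snd s) of
        (y, t) \<Rightarrow> (\<psi> (y + t *\<^sub>R w) - \<psi> y) / t < d - e"
      by (rule eventually_compose_filterlim[OF w])
    with v show "\<forall>\<^sub>F (y, t) in ?F. (\<psi> (y + t *\<^sub>R (v + w)) - \<psi> y) / t < d"
      by eventually_elim (auto simp: algebra_simps diff_divide_distrib)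
  qed
next
  let ?F = "nhds z \<times>\<^sub>F at_right (0::real)"
  fix c :: real and v assume c: "c > 0"
  show "clarke_real \<psi> z (c *\<^sub>R v) \<le> c * clarke_real \<psi> z v"
    unfolding clarke_real_le_iff[OF \<psi>]
  proof (intro allI impI)
    fix d assume d: "c * clarke_real \<psi> z v < d"
    then have "clarke_real \<psi> z v < d / c" using c by (simp add: field_simps)
    then have v: "\<forall>\<^sub>F (y, t) in ?F. (\<psi> (y + t *\<^sub>R v) - \<psi> y) / t < d / c"
      using clarke_real_le_iff[OF \<psi>, of z v "clarke_real \<psi> z v"] by simp
    have "filterlim (\<lambda>t. c * t) (at_right 0) (at_right (0::real))"
      using c by real_asymp
    then have "filterlim (\<lambda>s. (fst s, c * snd s)) ?F ?F"
      by (intro filterlim_Pair filterlim_fst filterlim_compose[OF _ filterlim_snd])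
    then have "\<forall>\<^sub>F s in ?F. case (fst s, c * snd s) of (y, t) \<Rightarrow> (\<psi> (y + t *\<^sub>R v) - \<psi> y) / t < d / c"
      by (rule eventually_compose_filterlim[OF v])
    then show "\<forall>\<^sub>F (y, t) in ?F. (\<psi> (y + t *\<^sub>R (c *\<^sub>R v)) - \<psi> y) / t < d"
    proof eventually_elim
      case (elim s)
      obtain y t where s: "s = (y, t)" by force
      have "(\<psi> (y + t *\<^sub>R (c *\<^sub>R v)) - \<psi> y) / t / c < d / c"
        using elim by (simp add: s mult.commute)
      then have "(\<psi> (y + t *\<^sub>R (c *\<^sub>R v)) - \<psi> y) / t < d"
        using c by (simp only: divide_less_cancel)
      then show ?case by (simp add: s)
    qed
  qed
qed

text \<open>The functional supporting the derivative at \<open>v\<close> lies below it everywhere,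
  so it is a Clarke subgradient, and it attains the derivative at \<open>v\<close>.\<close>

lemma clarke_real_le_norm:
  assumes \<psi>: "locally_lipschitz \<psi>"
    and bnd: "\<And>\<zeta>. \<zeta> \<in> clarke_subdiff \<psi> z \<Longrightarrow> norm \<zeta> \<le> M"
  shows "clarke_real \<psi> z v \<le> M * norm v"
proof -
  obtain L where "\<And>v. clarke_deriv \<psi> z v \<le> ereal (L * norm v)"
    using clarke_deriv_bounds[OF \<psi>] by metis
  then have "clarke_real \<psi> z v \<le> L * norm v" for v by (simp add: clarke_deriv_eq_real[OF \<psi>])
  then obtain \<zeta> :: "'a \<Rightarrow>\<^sub>L real" where \<zeta>: "\<And>x. blinfun_apply \<zeta> x \<le> clarke_real \<psi> z x"
      "blinfun_apply \<zeta> v = clarke_real \<psi> z v"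
    using sublinear_support_blinfun[OF sublinear_clarke_real[OF \<psi>]] by metis
  then have "norm \<zeta> \<le> M"
    by (intro bnd) (simp add: clarke_subdiff_def clarke_deriv_eq_real[OF \<psi>])
  have "clarke_real \<psi> z v \<le> norm \<zeta> * norm v"
    using \<zeta>(2) norm_blinfun[of \<zeta> v] by simp
  also have "\<dots> \<le> M * norm v" using \<open>norm \<zeta> \<le> M\<close> by (rule mult_right_mono) simp
  finally show ?thesis .
qed

section \<open>Weak cluster points and Minty's trick\<close>

text \<open>The evaluations at the \<open>x s\<close> lie in a product of compact intervals, so by Tychonoff a
  finer filter makes all of them converge; reflexivity represents the limit functional. This avoids
  the Eberlein--Smulian theorem.\<close>

lemma reflexive_weak_cluster:
  fixes x :: "'s \<Rightarrow> 'a::real_normed_vector"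
  assumes refl: "reflexive_space TYPE('a)" and F: "F \<noteq> bot"
    and bnd: "\<forall>\<^sub>F s in F. norm (x s) \<le> R"
  obtains G w where "G \<noteq> bot" "G \<le> F"
    "\<And>\<zeta> :: 'a \<Rightarrow>\<^sub>L real. ((\<lambda>s. blinfun_apply \<zeta> (x s)) \<longlongrightarrow> blinfun_apply \<zeta> w) G"
proof -
  define ev where "ev s = (\<lambda>\<zeta> :: 'a \<Rightarrow>\<^sub>L real. blinfun_apply \<zeta> (x s))" for s
  define U where "U = (\<Pi>\<^sub>E \<zeta>\<in>(UNIV::('a \<Rightarrow>\<^sub>L real) set). {- (norm \<zeta> * R) .. norm \<zeta> * R})"
  have "compactin (product_topology (\<lambda>_. euclidean) UNIV) U"
    unfolding U_def by (simp add: compactin_PiE)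
  then have "compact U" by (simp add: euclidean_product_topology)
  moreover have "filtermap ev F \<noteq> bot" using F by (simp add: filtermap_bot_iff)
  moreover have "\<forall>\<^sub>F e in filtermap ev F. e \<in> U"
    unfolding eventually_filtermap using bnd
  proof eventually_elim
    case (elim s)
    have "\<bar>blinfun_apply \<zeta> (x s)\<bar> \<le> norm \<zeta> * R" for \<zeta> :: "'a \<Rightarrow>\<^sub>L real"
      using norm_blinfun[of \<zeta> "x s"] mult_left_mono[OF elim, of "norm \<zeta>"] by simp
    then have "blinfun_apply \<zeta> (x s) \<in> {- (norm \<zeta> * R) .. norm \<zeta> * R}" for \<zeta> :: "'a \<Rightarrow>\<^sub>L real"
      by (simp only: abs_le_iff atLeastAtMost_iff minus_le_iff)
    then show ?case by (simp only: U_def ev_def PiE_UNIV_domain Pi_iff) blast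
  qed
  ultimately obtain \<phi> where \<phi>: "inf (nhds \<phi>) (filtermap ev F) \<noteq> bot"
    by (auto simp: compact_filter)
  \<comment> \<open>Pulling the neighbourhoods of \<phi> back along \<open>ev\<close> moves the
    cluster point from the image filter to the index set: all evaluations converge along
    \<open>G\<close> at once.\<close>
  define G where "G = inf F (filtercomap ev (nhds \<phi>))"
  have G: "G \<noteq> bot"
  proof
    assume "G = bot"
    then have "\<forall>\<^sub>F s in G. False" by simp
    then obtain P Q where "eventually P F" "eventually Q (filtercomap ev (nhds \<phi>))"
      and PQ: "\<And>s. P s \<Longrightarrow> Q s \<Longrightarrow> False"
      unfolding G_def eventually_inf by blast
    then obtain Q' where "eventually Q' (nhds \<phi>)" "\<And>s. Q' (ev s) \<Longrightarrow> Q s"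
      unfolding eventually_filtercomap by blast
    moreover have "eventually (\<lambda>e. \<exists>s. P s \<and> e = ev s) (filtermap ev F)"
      unfolding eventually_filtermap using \<open>eventually P F\<close> by eventually_elim blast
    ultimately have "eventually (\<lambda>_. False) (inf (nhds \<phi>) (filtermap ev F))"
      unfolding eventually_inf using PQ by blast
    with \<phi> show False by (simp add: trivial_limit_def)
  qed
  have "filterlim ev (nhds \<phi>) G"
    unfolding G_def by (rule filterlim_mono[OF filterlim_filtercomap order.refl]) simp
  then have lim: "((\<lambda>s. blinfun_apply \<zeta> (x s)) \<longlongrightarrow> \<phi> \<zeta>) G" for \<zeta>
  proof -
    have cont: "continuous_on UNIV (\<lambda>e :: ('a \<Rightarrow>\<^sub>L real) \<Rightarrow> real. e \<zeta>)"
      by (rule continuous_on_product_then_coordinatewise) (rule continuous_on_id)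
    show ?thesis
    proof (rule topological_tendstoI)
      fix V :: "real set" assume V: "open V" "\<phi> \<zeta> \<in> V"
      have "\<forall>\<^sub>F e in nhds \<phi>. e \<in> (\<lambda>e. e \<zeta>) -` V"
        using V by (intro eventually_nhds_in_open open_vimage cont) auto
      then show "\<forall>\<^sub>F s in G. blinfun_apply \<zeta> (x s) \<in> V"
        using \<open>filterlim ev (nhds \<phi>) G\<close> by (auto simp: ev_def dest: eventually_compose_filterlim)
    qed
  qed
  have GF: "G \<le> F" by (simp add: G_def)
  \<comment> \<open>Linearity and the bound pass to the pointwise limit, so \<phi> is an element of
    the bidual.\<close>
  have "bounded_linear \<phi>"
  proof (rule bounded_linear_intro)
    show "\<phi> (\<zeta> + \<xi>) = \<phi> \<zeta> + \<phi> \<xi>" for \<zeta> \<xi>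
      using tendsto_add[OF lim[of \<zeta>] lim[of \<xi>]]
      by (intro tendsto_unique[OF G lim]) (simp add: blinfun.add_left)
    show "\<phi> (c *\<^sub>R \<zeta>) = c *\<^sub>R \<phi> \<zeta>" for c \<zeta>
      using tendsto_scaleR[OF tendsto_const lim[of \<zeta>]]
      by (intro tendsto_unique[OF G lim]) (simp add: blinfun.scaleR_left)
    show "norm (\<phi> \<zeta>) \<le> norm \<zeta> * R" for \<zeta>
    proof (rule tendsto_upperbound[OF tendsto_norm[OF lim[of \<zeta>]] _ G])
      have "\<forall>\<^sub>F s in G. norm (x s) \<le> R" using bnd GF by (rule filter_leD[rotated])
      then show "\<forall>\<^sub>F s in G. norm (blinfun_apply \<zeta> (x s)) \<le> norm \<zeta> * R"
      proof eventually_elim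
        case (elim s)
        then show ?case
          using norm_blinfun[of \<zeta> "x s"] mult_left_mono[OF elim, of "norm \<zeta>"] by simp
      qed
    qed
  qed
  then have "blinfun_apply (Blinfun \<phi>) = \<phi>" by (rule bounded_linear_Blinfun_apply)
  moreover obtain w where "\<And>\<zeta>. blinfun_apply (Blinfun \<phi>) \<zeta> = blinfun_apply \<zeta> w"
    using refl unfolding reflexive_space_def by blast
  ultimately show thesis using that[OF G GF] lim by metis
qed

text \<open>Minty's trick: at \<open>v = w - t *\<^sub>R z\<close> with \<open>t > 0\<close> the
  hypothesis bounds \<open>t\<close> times the pairing of \<open>P v\<close> with \<open>z\<close>
  by 0. Divide by \<open>t\<close>, let \<open>t\<close> tend to 0, and use both \<open>z\<close>
  and \<open>- z\<close>.\<close>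

lemma minty_zero:
  fixes P :: "'a::real_normed_vector \<Rightarrow> ('a \<Rightarrow>\<^sub>L real)"
  assumes "demicontinuous P" and le: "\<And>v. blinfun_apply (P v) (w - v) \<le> 0"
  shows "P w = 0"
proof -
  have nonpos: "blinfun_apply (P w) z \<le> 0" for z
  proof -
    define v where "v n = w - inverse (real (Suc n)) *\<^sub>R z" for n
    have "v \<longlonglongrightarrow> w - 0 *\<^sub>R z"
      unfolding v_def by (intro tendsto_intros LIMSEQ_inverse_real_of_nat)
    then have W: "weakly_tendsto (\<lambda>n. P (v n)) (P w)"
      using assms(1) by (simp add: demicontinuous_def)
    \<comment> \<open>Demicontinuity is tested on the bidual, so evaluation at \<open>z\<close> has
      to be presented as an element of it.\<close>
    define ev where "ev = Blinfun (\<lambda>\<zeta> :: 'a \<Rightarrow>\<^sub>L real. blinfun_apply \<zeta> z)"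
    have ev: "blinfun_apply ev \<zeta> = blinfun_apply \<zeta> z" for \<zeta>
      unfolding ev_def by (simp add: bounded_linear_Blinfun_apply blinfun.bounded_linear_left)
    have "(\<lambda>n. blinfun_apply ev (P (v n))) \<longlonglongrightarrow> blinfun_apply ev (P w)"
      using W unfolding weakly_tendsto_def by blast
    then have "(\<lambda>n. blinfun_apply (P (v n)) z) \<longlonglongrightarrow> blinfun_apply (P w) z"
      by (simp only: ev)
    moreover have "blinfun_apply (P (v n)) z \<le> 0" for n
    proof -
      have "w - v n = inverse (real (Suc n)) *\<^sub>R z" by (simp add: v_def)
      with le[of "v n"] have "inverse (real (Suc n)) * blinfun_apply (P (v n)) z \<le> 0"
        by (simp only: blinfun.scaleR_right real_scaleR_def)
      then show ?thesis by (simp only: mult_le_0_iff) (auto simp del: of_nat_Suc)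
    qed
    ultimately show ?thesis by (intro LIMSEQ_le_const2) auto
  qed
  show ?thesis
  proof (rule blinfun_eqI)
    show "blinfun_apply (P w) z = blinfun_apply 0 z" for z
      using nonpos[of z] nonpos[of "- z"] by (simp add: blinfun.minus_right)
  qed
qed


section \<open>Convergence of the penalized discrete solutions\<close>

lemma bounded_operatorE:
  assumes "bounded_operator T"
  obtains M where "M \<ge> 0" "\<And>x. norm x \<le> R \<Longrightarrow> norm (T x) \<le> M"
proof -
  have "bounded (T ` cball 0 R)" using assms by (simp add: bounded_operator_def)
  then obtain M where "\<forall>x\<in>T ` cball 0 R. norm x \<le> M" by (auto simp: bounded_iff)
  then have "norm (T x) \<le> max M 0" if "norm x \<le> R" for x using that by force
  then show thesis by (intro that[of "max M 0"]) auto
qed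

theorem corollary6p1:
  fixes K :: "'x::banach set"
    and \<gamma> :: "'x \<Rightarrow>\<^sub>L 'y::banach"
    and A P :: "'x \<Rightarrow> ('x \<Rightarrow>\<^sub>L real)"
    and j :: "'y \<Rightarrow> real"
    and f :: "'x \<Rightarrow>\<^sub>L real"
    and X\<^sub>h :: "real \<Rightarrow> 'x set"
    and u :: 'x
    and u\<^sub>h :: "real \<Rightarrow> real \<Rightarrow> 'x"
    and c\<^sub>j m\<^sub>A c\<^sub>0 c\<^sub>1 \<alpha>\<^sub>j :: real
  assumes A1: "reflexive_space TYPE('x)"
      "K \<subset> UNIV" "K \<noteq> {}" "closed K" "convex K"
    and A3: "c\<^sub>j > 0" "\<And>v. norm (\<gamma> v) \<le> c\<^sub>j * norm v"
    and A4: "pseudomonotone A" "m\<^sub>A > 0"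
      "\<And>v1 v2. blinfun_apply (A v1 - A v2) (v1 - v2) \<ge> m\<^sub>A * (norm (v1 - v2))\<^sup>2"
    and A6: "locally_lipschitz j" "c\<^sub>0 \<ge> 0" "c\<^sub>1 \<ge> 0" "\<alpha>\<^sub>j \<ge> 0"
      "\<And>z \<zeta>. \<zeta> \<in> clarke_subdiff j z \<Longrightarrow> norm \<zeta> \<le> c\<^sub>0 + c\<^sub>1 * norm z"
      "\<And>z1 z2. clarke_deriv j z1 (z2 - z1) + clarke_deriv j z2 (z1 - z2)
                 \<le> ereal (\<alpha>\<^sub>j * (norm (z1 - z2))\<^sup>2)"
    and A7: "\<alpha>\<^sub>j * c\<^sub>j\<^sup>2 < m\<^sub>A"
    and A9: "\<And>h. h > 0 \<Longrightarrow> finite_dim_subspace (X\<^sub>h h)"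
      "\<And>v. \<exists>v\<^sub>h. (\<forall>h>0. v\<^sub>h h \<in> X\<^sub>h h) \<and> ((\<lambda>h. norm (v\<^sub>h h - v)) \<longlongrightarrow> 0) (at_right 0)"
      "\<And>v. v \<in> K \<Longrightarrow>
         \<exists>v\<^sub>h. (\<forall>h>0. v\<^sub>h h \<in> X\<^sub>h h \<inter> K) \<and> ((\<lambda>h. norm (v\<^sub>h h - v)) \<longlongrightarrow> 0) (at_right 0)"
    and A10: "compact_operator \<gamma>"
    and P: "penalty_operator K P"
    and u: "u \<in> K"
      "\<And>v. v \<in> K \<Longrightarrow>
         ereal (blinfun_apply (A u) (v - u)) + clarke_deriv j (\<gamma> u) (\<gamma> v - \<gamma> u)
           \<ge> ereal (blinfun_apply f (v - u))"
    and u\<^sub>h: "\<And>h \<epsilon>. h > 0 \<Longrightarrow> \<epsilon> > 0 \<Longrightarrow> u\<^sub>h h \<epsilon> \<in> X\<^sub>h h"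
      "\<And>h \<epsilon> v. h > 0 \<Longrightarrow> \<epsilon> > 0 \<Longrightarrow> v \<in> X\<^sub>h h \<Longrightarrow>
         ereal (blinfun_apply (A (u\<^sub>h h \<epsilon>)) (v - u\<^sub>h h \<epsilon>)
                + 1 / \<epsilon> * blinfun_apply (P (u\<^sub>h h \<epsilon>)) (v - u\<^sub>h h \<epsilon>))
           + clarke_deriv j (\<gamma> (u\<^sub>h h \<epsilon>)) (\<gamma> v - \<gamma> (u\<^sub>h h \<epsilon>))
           \<ge> ereal (blinfun_apply f (v - u\<^sub>h h \<epsilon>))"
  shows "\<forall>\<eta>>0. \<exists>h\<^sub>0>0. \<exists>\<epsilon>\<^sub>0>0. \<forall>h \<epsilon>. 0 < h \<and> h < h\<^sub>0 \<and> 0 < \<epsilon> \<and> \<epsilon> < \<epsilon>\<^sub>0 \<longrightarrow>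
           norm (u\<^sub>h h \<epsilon> - u) < \<eta>"
proof -
  \<comment> \<open>Eventually along this product means for all positive \<open>h\<close> and
    \<epsilon> below separate thresholds, so it encodes the independent limits.\<close>
  define F where "F = at_right (0::real) \<times>\<^sub>F at_right (0::real)"
  define U where "U s = u\<^sub>h (fst s) (snd s)" for s
  \<comment> \<open>What strong monotonicity retains after absorbing the nonconvexity of
    \<open>j\<close>.\<close>
  define \<kappa> where "\<kappa> = m\<^sub>A - \<alpha>\<^sub>j * c\<^sub>j\<^sup>2"
  let ?D = "clarke_real j"
  have \<kappa>: "\<kappa> > 0" using A7 by (simp add: \<kappa>_def)
  have D: "sublinear (?D z)" for z by (rule sublinear_clarke_real[OF A6(1)])
  have D_bound: "?D (\<gamma> x) (\<gamma> v) \<le> (c\<^sub>0 + c\<^sub>1 * (c\<^sub>j * norm x)) * c\<^sub>j * norm v" for x v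
  proof -
    have "?D (\<gamma> x) (\<gamma> v) \<le> (c\<^sub>0 + c\<^sub>1 * norm (\<gamma> x)) * norm (\<gamma> v)"
      by (rule clarke_real_le_norm[OF A6(1,5)])
    also have "\<dots> \<le> (c\<^sub>0 + c\<^sub>1 * (c\<^sub>j * norm x)) * (c\<^sub>j * norm v)"
      using A3 A6(2,3) by (intro mult_mono add_mono mult_left_mono) auto
    finally show ?thesis by (simp add: mult.assoc)
  qed
  have D_sym: "?D z1 (z2 - z1) + ?D z2 (z1 - z2) \<le> \<alpha>\<^sub>j * (norm (z1 - z2))\<^sup>2" for z1 z2
    using A6(6)[of z1 z2] by (simp add: clarke_deriv_eq_real[OF A6(1)])
  \<comment> \<open>Strong monotonicity of \<open>A\<close> and relaxed monotonicity of the Clarke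
    derivative are combined; the bound on \<gamma> turns \<open>\<alpha>\<^sub>j\<close> into
    \<open>\<alpha>\<^sub>j * c\<^sub>j\<^sup>2\<close>, which leaves \<kappa>.\<close>
  have key: "\<kappa> * (norm (n - b))\<^sup>2 \<le> blinfun_apply (A n) (n - b) - blinfun_apply (A b) (n - b)
      - ?D (\<gamma> n) (\<gamma> b - \<gamma> n) - ?D (\<gamma> b) (\<gamma> n - \<gamma> b)" for n b
  proof -
    have "norm (\<gamma> n - \<gamma> b) \<le> c\<^sub>j * norm (n - b)"
      using A3(2)[of "n - b"] by (simp add: blinfun.diff_right)
    then have "(norm (\<gamma> n - \<gamma> b))\<^sup>2 \<le> (c\<^sub>j * norm (n - b))\<^sup>2" by (rule power_mono) simp
    then have "\<alpha>\<^sub>j * (norm (\<gamma> n - \<gamma> b))\<^sup>2 \<le> \<alpha>\<^sub>j * (c\<^sub>j * norm (n - b))\<^sup>2"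
      using A6(4) by (rule mult_left_mono)
    then show ?thesis
      using D_sym[of "\<gamma> n" "\<gamma> b"] A4(3)[of n b]
      by (simp add: \<kappa>_def blinfun.diff_left algebra_simps power_mult_distrib)
  qed
  have A_bounded: "bounded_operator A" using A4(1) by (simp add: pseudomonotone_def)
  have P_bounded: "bounded_operator P" using P by (simp add: penalty_operator_def)
  have P_ker: "P v = 0" if "v \<in> K" for v using P that by (auto simp: penalty_operator_def)
  have P_mono: "blinfun_apply (P a) (b - a) \<le> blinfun_apply (P b) (b - a)" for a b
    using P by (auto simp: penalty_operator_def monotone_operator_def blinfun.diff_left)
  have test: "1 / \<epsilon> * blinfun_apply (P n) (n - z) \<le> blinfun_apply (A n - f) (z - n)
      + ?D (\<gamma> n) (\<gamma> z - \<gamma> n)"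
    if "h > 0" "\<epsilon> > 0" "z \<in> X\<^sub>h h" "n = u\<^sub>h h \<epsilon>" for h \<epsilon> z n
  proof -
    have "blinfun_apply (P n) (n - z) = - blinfun_apply (P n) (z - n)"
      by (simp add: blinfun.diff_right)
    then show ?thesis
      using u\<^sub>h(2)[OF that(1,2,3)] that(4)
      by (simp add: clarke_deriv_eq_real[OF A6(1)] blinfun.diff_left)
  qed
  have pos: "\<forall>\<^sub>F s in F. fst s > 0 \<and> snd s > 0"
    unfolding F_def
    by (intro eventually_conj eventually_compose_filterlim[OF _ filterlim_fst]
        eventually_compose_filterlim[OF _ filterlim_snd] eventually_at_right_less)
  have approx: "((\<lambda>s. norm (g (fst s) - v)) \<longlongrightarrow> 0) F"
    if "((\<lambda>h. norm (g h - v)) \<longlongrightarrow> 0) (at_right 0)" for g :: "real \<Rightarrow> 'x" and v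
    unfolding F_def by (rule filterlim_compose[OF that filterlim_fst])
  obtain v\<^sub>h where v\<^sub>h: "\<And>h. h > 0 \<Longrightarrow> v\<^sub>h h \<in> X\<^sub>h h \<inter> K"
      "((\<lambda>h. norm (v\<^sub>h h - u)) \<longlongrightarrow> 0) (at_right 0)"
    using A9(3)[OF u(1)] by blast
  define V where "V s = v\<^sub>h (fst s)" for s :: "real \<times> real"
  have V: "((\<lambda>s. norm (V s - u)) \<longlongrightarrow> 0) F" unfolding V_def by (rule approx[OF v\<^sub>h(2)])
  \<comment> \<open>Monotonicity and \<open>P (V s) = 0\<close> make the penalty term nonnegative,
    so it drops out however large its factor is.\<close>
  have test_V: "blinfun_apply (A (U s)) (U s - V s) \<le> blinfun_apply f (U s - V s)
      + ?D (\<gamma> (U s)) (\<gamma> (V s) - \<gamma> (U s))" if "fst s > 0" "snd s > 0" for s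
  proof -
    have "0 \<le> blinfun_apply (P (U s)) (U s - V s)"
      using P_mono[of "V s" "U s"] P_ker v\<^sub>h(1)[OF that(1)] by (simp add: V_def)
    then have "0 \<le> 1 / snd s * blinfun_apply (P (U s)) (U s - V s)"
      using that by (intro mult_nonneg_nonneg) auto
    then show ?thesis
      using test[OF that, of "V s" "U s"] v\<^sub>h(1)[OF that(1)]
      by (simp add: U_def V_def blinfun.diff_left blinfun.diff_right)
  qed
  \<comment> \<open>A priori bound: once \<open>V s\<close> is within distance 1 of
    \<open>u\<close>, the square of the distance from \<open>U s\<close> to \<open>V s\<close> is
    controlled by a multiple of that distance.\<close>
  have "\<exists>R. \<forall>\<^sub>F s in F. norm (U s) \<le> R"
  proof -
    define r where "r = norm u + 1"
    obtain M where M: "M \<ge> 0" "\<And>x. norm x \<le> r \<Longrightarrow> norm (A x) \<le> M"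
      using bounded_operatorE[OF A_bounded] by blast
    define C where "C = norm f + M + (c\<^sub>0 + c\<^sub>1 * (c\<^sub>j * r)) * c\<^sub>j"
    have "\<forall>\<^sub>F s in F. norm (V s - u) < 1" using V by (rule order_tendstoD) simp
    with pos have "\<forall>\<^sub>F s in F. norm (U s) \<le> r + C / \<kappa>"
    proof eventually_elim
      case (elim s)
      have Vr: "norm (V s) \<le> r"
        using elim norm_triangle_ineq[of "V s - u" u] by (simp add: r_def)
      let ?d = "norm (U s - V s)"
      have "\<kappa> * ?d\<^sup>2 \<le> blinfun_apply (f - A (V s)) (U s - V s) - ?D (\<gamma> (V s)) (\<gamma> (U s) - \<gamma> (V s))"
        using key[of "U s" "V s"] test_V[of s] elim by (simp add: blinfun.diff_left)
      \<comment> \<open>\<open>D_bound\<close> works from above only; sublinearity trades the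
        negative term for the derivative in the opposite direction.\<close>
      also have "- ?D (\<gamma> (V s)) (\<gamma> (U s) - \<gamma> (V s)) \<le> ?D (\<gamma> (V s)) (\<gamma> (V s - U s))"
        using sublinear_minus[OF D, of "\<gamma> (V s)" "\<gamma> (V s - U s)"] by (simp add: blinfun.diff_right)
      then have "blinfun_apply (f - A (V s)) (U s - V s) - ?D (\<gamma> (V s)) (\<gamma> (U s) - \<gamma> (V s))
        \<le> blinfun_apply (f - A (V s)) (U s - V s) + ?D (\<gamma> (V s)) (\<gamma> (V s - U s))" by simp
      also have "\<dots> \<le> (norm f + M) * ?d + (c\<^sub>0 + c\<^sub>1 * (c\<^sub>j * r)) * c\<^sub>j * ?d"
      proof (rule add_mono)
        have "blinfun_apply (f - A (V s)) (U s - V s) \<le> norm (f - A (V s)) * ?d"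
          using norm_blinfun[of "f - A (V s)" "U s - V s"] by simp
        also have "\<dots> \<le> (norm f + M) * ?d"
          using norm_triangle_ineq4[of f "A (V s)"] M(2)[OF Vr] by (intro mult_right_mono) auto
        finally show "blinfun_apply (f - A (V s)) (U s - V s) \<le> (norm f + M) * ?d" .
        have "?D (\<gamma> (V s)) (\<gamma> (V s - U s)) \<le> (c\<^sub>0 + c\<^sub>1 * (c\<^sub>j * norm (V s))) * c\<^sub>j * ?d"
          using D_bound[of "V s" "V s - U s"] by (simp add: norm_minus_commute)
        also have "\<dots> \<le> (c\<^sub>0 + c\<^sub>1 * (c\<^sub>j * r)) * c\<^sub>j * ?d"
          using Vr A3(1) A6(2,3) by (intro mult_right_mono add_left_mono mult_left_mono) auto
        finally show "?D (\<gamma> (V s)) (\<gamma> (V s - U s)) \<le> (c\<^sub>0 + c\<^sub>1 * (c\<^sub>j * r)) * c\<^sub>j * ?d" .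
      qed
      also have "\<dots> = C * ?d" by (simp add: C_def algebra_simps)
      finally have "\<kappa> * ?d * ?d \<le> C * ?d" by (simp add: power2_eq_square mult.assoc)
      \<comment> \<open>This sign settles the case \<open>?d = 0\<close>, where \<open>?d\<close>
        cannot be cancelled.\<close>
      moreover have "C \<ge> 0"
        using A3(1) A6(2,3) M(1)
        unfolding C_def r_def by (intro add_nonneg_nonneg mult_nonneg_nonneg) auto
      ultimately have "\<kappa> * ?d \<le> C" by (cases "?d = 0") (auto simp: mult_le_cancel_right)
      then have "?d \<le> C / \<kappa>" using \<kappa> by (simp add: field_simps)
      then show ?case using norm_triangle_ineq[of "U s - V s" "V s"] Vr by simp
    qed
    then show ?thesis by blast
  qed
  then obtain R where R: "\<forall>\<^sub>F s in F. norm (U s) \<le> R" by blast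
  obtain M where M: "\<And>x. norm x \<le> R \<Longrightarrow> norm (A x) \<le> M"
    using bounded_operatorE[OF A_bounded] by blast
  obtain M' where M': "M' \<ge> 0" "\<And>x. norm x \<le> R \<Longrightarrow> norm (P x) \<le> M'"
    using bounded_operatorE[OF P_bounded] by blast
  define C where "C = norm f + M + (c\<^sub>0 + c\<^sub>1 * (c\<^sub>j * R)) * c\<^sub>j"
  \<comment> \<open>A bound on the residual of the discrete inequality, uniform in \<open>n\<close>.
    It controls both the test points \<open>Z s\<close> in the penalty estimate and the replacement
    of \<open>V s\<close> by \<open>u\<close> at the end.\<close>
  have error: "blinfun_apply (A n - f) v + ?D (\<gamma> n) (\<gamma> v) \<le> C * norm v" if "norm n \<le> R" for n v
  proof -
    have "blinfun_apply (A n - f) v \<le> norm (A n - f) * norm v"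
      using norm_blinfun[of "A n - f" v] by simp
    also have "\<dots> \<le> (norm f + M) * norm v"
      using norm_triangle_ineq4[of "A n" f] M[OF that] by (intro mult_right_mono) auto
    finally have "blinfun_apply (A n - f) v \<le> (norm f + M) * norm v" .
    moreover have "(c\<^sub>0 + c\<^sub>1 * (c\<^sub>j * norm n)) * c\<^sub>j * norm v \<le> (c\<^sub>0 + c\<^sub>1 * (c\<^sub>j * R)) * c\<^sub>j * norm v"
      using that A3(1) A6(2,3) by (intro mult_right_mono add_left_mono mult_left_mono) auto
    ultimately show ?thesis
      using D_bound[of n v] by (simp add: C_def distrib_right)
  qed
  \<comment> \<open>Multiplied by \<epsilon>, the discrete inequality bounds the penalty term by
    \<epsilon> times a bounded residual. Monotonicity then moves \<open>P\<close> from
    \<open>U s\<close> to the fixed \<open>z\<close>, which makes the left-hand side affine in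
    \<open>U s\<close>.\<close>
  have penalty_vanishes: "\<exists>e. (e \<longlongrightarrow> 0) F \<and> (\<forall>\<^sub>F s in F. blinfun_apply (P z) (U s - z) \<le> e s)" for z
  proof -
    obtain z\<^sub>h where z\<^sub>h: "\<And>h. h > 0 \<Longrightarrow> z\<^sub>h h \<in> X\<^sub>h h"
        "((\<lambda>h. norm (z\<^sub>h h - z)) \<longlongrightarrow> 0) (at_right 0)"
      using A9(2)[of z] by blast
    define Z where "Z s = z\<^sub>h (fst s)" for s :: "real \<times> real"
    \<comment> \<open>The first term is \<epsilon> times the residual bound, with
      \<open>norm (Z s - U s)\<close> estimated through \<open>z\<close>; the second is the price of
      replacing \<open>Z s\<close> by \<open>z\<close>. The absolute value is taken because no sign
      of \<open>C\<close> has been established.\<close>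
    define e where "e s = snd s * (\<bar>C\<bar> * (norm (Z s - z) + norm z + R)) + M' * norm (Z s - z)" for s
    have Z: "((\<lambda>s. norm (Z s - z)) \<longlongrightarrow> 0) F" unfolding Z_def by (rule approx[OF z\<^sub>h(2)])
    have "(snd \<longlongrightarrow> 0) F"
      unfolding F_def by (rule filterlim_mono[OF filterlim_snd at_within_le_nhds order_refl])
    then have "(e \<longlongrightarrow> 0 * (\<bar>C\<bar> * (0 + norm z + R)) + M' * 0) F"
      unfolding e_def by (intro tendsto_intros Z)
    moreover have "\<forall>\<^sub>F s in F. blinfun_apply (P z) (U s - z) \<le> e s"
      using pos R
    proof eventually_elim
      case (elim s)
      have "1 / snd s * blinfun_apply (P (U s)) (U s - Z s) \<le> C * norm (Z s - U s)"
        using test[of "fst s" "snd s" "Z s" "U s"] elim z\<^sub>h(1) error[of "U s" "Z s - U s"]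
        by (simp add: U_def Z_def blinfun.diff_right)
      also have "\<dots> \<le> \<bar>C\<bar> * (norm (Z s - z) + norm z + R)"
        using elim norm_triangle_ineq4[of "Z s" "U s"] norm_triangle_ineq[of "Z s - z" z]
        by (intro mult_mono) auto
      finally have "blinfun_apply (P (U s)) (U s - Z s) \<le> snd s * (\<bar>C\<bar> * (norm (Z s - z) + norm z + R))"
        using elim by (simp add: field_simps)
      moreover have "blinfun_apply (P (U s)) (Z s - z) \<le> M' * norm (Z s - z)"
        using norm_blinfun[of "P (U s)" "Z s - z"] M'(2)[of "U s"] elim
          mult_right_mono[of "norm (P (U s))" M' "norm (Z s - z)"] by simp
      ultimately show ?case
        using P_mono[of z "U s"] by (simp add: e_def blinfun.diff_right)
    qed
    ultimately show ?thesis by auto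
  qed
  have "\<forall>\<^sub>F s in F. norm (U s - u) < \<eta>" if \<eta>: "\<eta> > 0" for \<eta>
  proof (rule ccontr)
    assume far: "\<not> (\<forall>\<^sub>F s in F. norm (U s - u) < \<eta>)"
    \<comment> \<open>If the claim fails, restricting \<open>F\<close> to the points far from
      \<open>u\<close> leaves a proper filter, so a weak cluster point exists along which the
      distance stays at least \<eta>.\<close>
    define F' where "F' = inf F (principal {s. \<eta> \<le> norm (U s - u)})"
    have "F' \<noteq> bot"
      using far by (simp add: F'_def trivial_limit_def eventually_inf_principal not_le)
    moreover have "\<forall>\<^sub>F s in F'. norm (U s) \<le> R"
      using R by (simp add: F'_def eventually_inf_principal eventually_mono)
    ultimately obtain G w where G: "G \<noteq> bot" "G \<le> F'" and
      w: "\<And>\<zeta> :: 'x \<Rightarrow>\<^sub>L real. ((\<lambda>s. blinfun_apply \<zeta> (U s)) \<longlongrightarrow> blinfun_apply \<zeta> w) G"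
      using reflexive_weak_cluster[OF A1(1)] by blast
    have GF: "G \<le> F" using G(2) by (simp add: F'_def)
    have w': "((\<lambda>s. blinfun_apply \<zeta> (U s - z)) \<longlongrightarrow> blinfun_apply \<zeta> (w - z)) G"
      for \<zeta> :: "'x \<Rightarrow>\<^sub>L real" and z
      unfolding blinfun.diff_right by (intro tendsto_intros w)
    \<comment> \<open>Being affine in \<open>U s\<close>, the bound passes to the weak limit.
      Minty's trick then places \<open>w\<close> in \<open>K\<close>, where it may test the
      inequality for \<open>u\<close>.\<close>
    have "blinfun_apply (P z) (w - z) \<le> 0" for z
    proof -
      obtain e where e: "(e \<longlongrightarrow> 0) F" "\<forall>\<^sub>F s in F. blinfun_apply (P z) (U s - z) \<le> e s"
        using penalty_vanishes by blast
      show ?thesis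
        by (rule tendsto_le[OF G(1) tendsto_mono[OF GF e(1)] w' filter_leD[OF GF e(2)]])
    qed
    then have "P w = 0"
      using P by (intro minty_zero) (auto simp: penalty_operator_def)
    then have wK: "w \<in> K" using P by (auto simp: penalty_operator_def)
    \<comment> \<open>Weak limits are taken in linear functionals, so \<open>p\<close> is replaced
      by a linear minorant that is exact at \<open>w - u\<close>, the limit of
      \<open>U s - u\<close>.\<close>
    define p where "p x = ?D (\<gamma> u) (\<gamma> x)" for x
    have "sublinear p"
      unfolding p_def using sublinear_add[OF D] sublinear_scaleR_le[OF D]
      by (intro sublinearI) (simp_all add: blinfun.add_right blinfun.scaleR_right)
    moreover have "p x \<le> (c\<^sub>0 + c\<^sub>1 * (c\<^sub>j * norm u)) * c\<^sub>j * norm x" for x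
      unfolding p_def by (rule D_bound)
    ultimately obtain \<zeta> :: "'x \<Rightarrow>\<^sub>L real"
      where \<zeta>: "\<And>x. blinfun_apply \<zeta> x \<le> p x" "blinfun_apply \<zeta> (w - u) = p (w - u)"
      using sublinear_support_blinfun by blast
    have limit: "0 \<le> blinfun_apply (A u - f) (w - u) + blinfun_apply \<zeta> (w - u)"
      using u(2)[OF wK] \<zeta>(2)
      by (simp add: p_def clarke_deriv_eq_real[OF A6(1)] blinfun.diff_left blinfun.diff_right)
    \<comment> \<open>This is \<open>key\<close> with \<open>b = u\<close>, the terms at
      \<open>U s\<close> being eliminated by \<open>test_V\<close>; trading \<open>V s\<close> for
      \<open>u\<close> as test element costs \<open>C * norm (V s - u)\<close>.\<close>
    have "\<forall>\<^sub>F s in F. \<kappa> * (norm (U s - u))\<^sup>2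
      \<le> C * norm (V s - u) - blinfun_apply (A u - f) (U s - u) - blinfun_apply \<zeta> (U s - u)"
      using pos R
    proof eventually_elim
      case (elim s)
      have "?D (\<gamma> (U s)) (\<gamma> (V s) - \<gamma> (U s))
          \<le> ?D (\<gamma> (U s)) (\<gamma> u - \<gamma> (U s)) + ?D (\<gamma> (U s)) (\<gamma> (V s - u))"
        using sublinear_add[OF D, of "\<gamma> (U s)" "\<gamma> u - \<gamma> (U s)" "\<gamma> (V s - u)"]
        by (simp add: blinfun.diff_right)
      moreover have "blinfun_apply \<zeta> (U s - u) \<le> ?D (\<gamma> u) (\<gamma> (U s) - \<gamma> u)"
        using \<zeta>(1)[of "U s - u"] by (simp add: p_def blinfun.diff_right)
      ultimately show ?case
        using key[of "U s" u] test_V[of s] error[of "U s" "V s - u"] elim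
        by (simp add: blinfun.diff_left blinfun.diff_right)
    qed
    then have "\<forall>\<^sub>F s in F'. \<kappa> * \<eta>\<^sup>2
      \<le> C * norm (V s - u) - blinfun_apply (A u - f) (U s - u) - blinfun_apply \<zeta> (U s - u)"
      unfolding F'_def eventually_inf_principal
    proof eventually_elim
      case (elim s)
      show ?case
      proof
        assume "s \<in> {s. \<eta> \<le> norm (U s - u)}"
        then have "\<eta>\<^sup>2 \<le> (norm (U s - u))\<^sup>2" using \<eta> by (intro power_mono) auto
        then have "\<kappa> * \<eta>\<^sup>2 \<le> \<kappa> * (norm (U s - u))\<^sup>2" using \<kappa> by simp
        with elim show "\<kappa> * \<eta>\<^sup>2 \<le> C * norm (V s - u)
          - blinfun_apply (A u - f) (U s - u) - blinfun_apply \<zeta> (U s - u)" by simp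
      qed
    qed
    then have "\<forall>\<^sub>F s in G. \<kappa> * \<eta>\<^sup>2
      \<le> C * norm (V s - u) - blinfun_apply (A u - f) (U s - u) - blinfun_apply \<zeta> (U s - u)"
      by (rule filter_leD[OF G(2)])
    moreover have "((\<lambda>s. C * norm (V s - u) - blinfun_apply (A u - f) (U s - u)
        - blinfun_apply \<zeta> (U s - u))
      \<longlongrightarrow> C * 0 - blinfun_apply (A u - f) (w - u) - blinfun_apply \<zeta> (w - u)) G"
      by (intro tendsto_diff tendsto_mult tendsto_const w' tendsto_mono[OF GF V])
    \<comment> \<open>By \<open>limit\<close> this right-hand side is at most 0, which contradicts
      the positivity of \<kappa> and \<eta>.\<close>
    ultimately have "\<kappa> * \<eta>\<^sup>2 \<le> C * 0 - blinfun_apply (A u - f) (w - u) - blinfun_apply \<zeta> (w - u)"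
      using tendsto_lowerbound G(1) by blast
    with limit have "\<kappa> * \<eta>\<^sup>2 \<le> 0" by simp
    moreover have "\<kappa> * \<eta>\<^sup>2 > 0" using \<kappa> \<eta> by simp
    ultimately show False by simp
  qed
  show ?thesis
  proof (intro allI impI)
    fix \<eta> :: real assume "\<eta> > 0"
    then have "\<forall>\<^sub>F s in F. norm (U s - u) < \<eta>" by fact
    then obtain Q Q' where Q: "eventually Q (at_right 0)" "eventually Q' (at_right 0)"
        "\<And>h \<epsilon>. Q h \<Longrightarrow> Q' \<epsilon> \<Longrightarrow> norm (u\<^sub>h h \<epsilon> - u) < \<eta>"
      unfolding F_def eventually_prod_filter U_def by auto
    obtain h\<^sub>0 where "h\<^sub>0 > 0" and h\<^sub>0: "\<And>h. 0 < h \<Longrightarrow> h < h\<^sub>0 \<Longrightarrow> Q h"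
      using Q(1) by (auto simp: eventually_at_right_field)
    obtain \<epsilon>\<^sub>0 where "\<epsilon>\<^sub>0 > 0" and \<epsilon>\<^sub>0: "\<And>\<epsilon>. 0 < \<epsilon> \<Longrightarrow> \<epsilon> < \<epsilon>\<^sub>0 \<Longrightarrow> Q' \<epsilon>"
      using Q(2) by (auto simp: eventually_at_right_field)
    show "\<exists>h\<^sub>0>0. \<exists>\<epsilon>\<^sub>0>0. \<forall>h \<epsilon>. 0 < h \<and> h < h\<^sub>0 \<and> 0 < \<epsilon> \<and> \<epsilon> < \<epsilon>\<^sub>0 \<longrightarrow>
        norm (u\<^sub>h h \<epsilon> - u) < \<eta>"
      using \<open>h\<^sub>0 > 0\<close> \<open>\<epsilon>\<^sub>0 > 0\<close> Q(3)[OF h\<^sub>0 \<epsilon>\<^sub>0] by (intro exI[of _ h\<^sub>0] exI[of _ \<epsilon>\<^sub>0] conjI) simp_all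
  qed
qed

end
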